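(* Let $X$ be a rooted tree on $n$ nodes with binary labels, let $k_{\max}$ denote the maximum number of children of a node in $X$, and let $d$ be the depth of $X$. In the AON deletion model with deletion probability $q<1$, there exists a finite constant $C$ depending only on $q$ such that $\exp(C k_{\max} d)$ independent traces suffice to reconstruct the labels of $X$ with high probability (i.e., there is an estimator which, given the topology, $q$ and that many traces, outputs the labels of $X$ with probability tending to $1$ as $n\to\infty$).
   Context: Tree trace reconstruction: $X$ is a rooted tree of known topology whose non-root nodes carry unknown binary labels; the children of every node have a left-to-right order. The depth of $X$ is the largest graph distance from the root to a leaf. AON (All-Or-Nothing) deletion model with parameter $q$: each non-root node is marked independently with probability $q$; a node is deleted if and only if it is marked or has a marked ancestor (i.e., the whole subtree rooted at a marked node is deleted); the root is never deleted. The surviving labeled ordered rooted tree (with inherited left-to-right orders) is the trace. The goal is to recover the labels of $X$ from independent traces, knowing the deletion model, $q$, and the topology of $X$. *)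

theory Defs
  imports "HOL-Probability.Probability" "HOL-Library.Sublist"
begin

text \<open>
  Rooted ordered trees whose non-root nodes carry labels: the children of a node are listed from
  left to right, each given as its label together with the subtree hanging from it.
  The root thus carries no label.
\<close>

datatype 'l otree = ONode "('l \<times> 'l otree) list"

text \<open>A node is addressed by the list of child indices on the path from the root to it.\<close>

function nodes :: "'l otree \<Rightarrow> nat list set" where
  "nodes (ONode ts) = insert [] (\<Union>i<length ts. (#) i ` nodes (snd (ts ! i)))"
  by pat_completeness auto

lemma size_nth_otree:
  "i < length ts \<Longrightarrow> size (snd (ts ! i)) < Suc (size_list (size_prod (\<lambda>_. 0) size) ts)"
  by (induction ts arbitrary: i) (fastforce simp: nth_Cons split: nat.splits)+

termination nodes
  by (relation "Wellfounded.measure size") (auto simp: size_nth_otree)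

lemma finite_nodes [simp]: "finite (nodes t)"
  by (induction t rule: nodes.induct) auto

definition children :: "'l otree \<Rightarrow> nat list \<Rightarrow> nat list set" where
  "children t v = {w \<in> nodes t. \<exists>i. w = v @ [i]}"

definition leaves :: "'l otree \<Rightarrow> nat list set" where
  "leaves t = {v \<in> nodes t. children t v = {}}"

definition num_nodes :: "'l otree \<Rightarrow> nat" where
  "num_nodes t = card (nodes t)"

definition max_children :: "'l otree \<Rightarrow> nat" where
  "max_children t = Max ((\<lambda>v. card (children t v)) ` nodes t)"

text \<open>The graph distance from the root to a node is the length of its address.\<close>

definition depth :: "'l otree \<Rightarrow> nat" where
  "depth t = Max (length ` leaves t)"

definition tree_topology :: "'l otree \<Rightarrow> unit otree" where
  "tree_topology t = map_otree (\<lambda>_. ()) t"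

definition marking_pmf :: "real \<Rightarrow> 'l otree \<Rightarrow> (nat list \<Rightarrow> bool) pmf" where
  "marking_pmf q t = Pi_pmf (nodes t - {[]}) False (\<lambda>_. bernoulli_pmf q)"

text \<open>
  All-or-nothing deletion: a non-root node is deleted iff it is marked or has a marked ancestor;
  marks never apply to the root.
\<close>

definition aon_deleted :: "(nat list \<Rightarrow> bool) \<Rightarrow> nat list \<Rightarrow> bool" where
  "aon_deleted M v \<longleftrightarrow> (\<exists>u. u \<noteq> [] \<and> prefix u v \<and> M u)"

text \<open>
  \<open>surviving D t\<close> is the tree left after removing the nodes satisfying \<open>D\<close>, for \<open>D\<close> closed under
  descendants; below the \<open>i\<close>-th child, \<open>D\<close> is re-expressed in addresses relative to that child.
\<close>

function surviving :: "(nat list \<Rightarrow> bool) \<Rightarrow> 'l otree \<Rightarrow> 'l otree" where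
  "surviving D (ONode ts) =
     ONode (map (\<lambda>i. (fst (ts ! i), surviving (\<lambda>v. D (i # v)) (snd (ts ! i))))
                (filter (\<lambda>i. \<not> D [i]) [0..<length ts]))"
  by pat_completeness auto

termination surviving
  by (relation "Wellfounded.measure (\<lambda>(D, t). size t)") (auto simp: size_nth_otree)

definition aon_trace_pmf :: "real \<Rightarrow> 'l otree \<Rightarrow> 'l otree pmf" where
  "aon_trace_pmf q t = map_pmf (\<lambda>M. surviving (aon_deleted M) t) (marking_pmf q t)"

end

theory Submission
  imports Defs "HOL-Real_Asymp.Real_Asymp"
begin

text \<open>
  If all children of every node on the path from the root to a node \<open>v\<close> survive, then the trace
  has full branching along this path, so the path can be located in the trace without ambiguity and
  the label of \<open>v\<close> can be read off; moreover this never yields a wrong label. The event has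
  probability at least \<open>(1 - q) ^ (k\<^sub>m\<^sub>a\<^sub>x d)\<close>, whereas \<open>n \<le> (1 + k\<^sub>m\<^sub>a\<^sub>x) ^ d \<le> exp (k\<^sub>m\<^sub>a\<^sub>x d)\<close>.
  Hence \<open>exp ((2 - ln (1 - q)) k\<^sub>m\<^sub>a\<^sub>x d)\<close> traces miss some node with probability at most
  \<open>n exp (- n\<^sup>2)\<close>.
\<close>

section \<open>Addresses, labels and the size of a tree\<close>

text \<open>The root carries no label, hence the placeholder \<open>undefined\<close>; values at
  addresses outside the tree are arbitrary too, so labels are only compared at non-root
  nodes.\<close>

primrec label :: "'l otree \<Rightarrow> nat list \<Rightarrow> 'l" where
  "label t [] = undefined"
| "label t (i # v) =
     (case t of ONode ts \<Rightarrow> if v = [] then fst (ts ! i) else label (snd (ts ! i)) v)"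

lemma Nil_in_nodes [simp]: "[] \<in> nodes t"
  by (cases t) auto

lemma Cons_in_nodes [simp]:
  "i # v \<in> nodes (ONode ts) \<longleftrightarrow> i < length ts \<and> v \<in> nodes (snd (ts ! i))"
  by auto

declare nodes.simps [simp del]

lemma append_in_nodesD: "u @ w \<in> nodes t \<Longrightarrow> u \<in> nodes t"
proof (induction u arbitrary: t)
  case (Cons i u)
  then show ?case by (cases t) auto
qed simp

lemma sibling_in_nodes: "v @ [i] \<in> nodes t \<Longrightarrow> j \<le> i \<Longrightarrow> v @ [j] \<in> nodes t"
proof (induction v arbitrary: t)
  case Nil
  then show ?case by (cases t) auto
next
  case (Cons a v)
  then show ?case by (cases t) auto
qed

lemma finite_children [simp]: "finite (children t v)"
  by (simp add: children_def)

lemma card_children_le: "v \<in> nodes t \<Longrightarrow> card (children t v) \<le> max_children t"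
  by (simp add: max_children_def)

text \<open>The siblings with indices 0 to \<open>i\<close> are already \<open>i + 1\<close>
  distinct children of \<open>v\<close>.\<close>

lemma index_less_max_children:
  assumes "v @ [i] \<in> nodes t"
  shows "i < max_children t"
proof -
  have "(\<lambda>j. v @ [j]) ` {..i} \<subseteq> children t v"
    using sibling_in_nodes[OF assms] by (auto simp: children_def)
  then have "card ((\<lambda>j. v @ [j]) ` {..i}) \<le> card (children t v)"
    by (intro card_mono) auto
  also have "\<dots> \<le> max_children t"
    using assms append_in_nodesD card_children_le by blast
  finally show ?thesis
    by (simp add: card_image inj_on_def)
qed

text \<open>As \<open>depth\<close> ranges over leaves only, a node with an address of maximal
  length is taken: a child would have a longer address, so this node is a leaf.\<close>

lemma length_le_depth:
  assumes "v \<in> nodes t"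
  shows "length v \<le> depth t"
proof -
  obtain w where w: "w \<in> nodes t" "length w = Max (length ` nodes t)"
    using Max_in[of "length ` nodes t"] assms by fastforce
  have max: "length u \<le> length w" if "u \<in> nodes t" for u
    using that w by simp
  have "w \<in> leaves t"
    using w(1) max by (fastforce simp: leaves_def children_def)
  moreover have "finite (leaves t)"
    by (simp add: leaves_def)
  ultimately have "length w \<le> depth t"
    by (simp add: depth_def)
  with max[OF assms] show ?thesis by simp
qed

text \<open>Addresses are words of length at most \<open>depth t\<close> over an alphabet of
  \<open>max_children t\<close> letters, and the number of such words is a geometric sum.\<close>

lemma num_nodes_le: "num_nodes t \<le> (1 + max_children t) ^ depth t"
proof -
  define k where "k = max_children t"
  have geometric_sum: "(\<Sum>i\<le>d. k ^ i) \<le> (1 + k) ^ d" for d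
  proof (induction d)
    case (Suc d)
    have "k * k ^ d \<le> k * (1 + k) ^ d"
      by (intro mult_left_mono power_mono) auto
    with Suc have "(\<Sum>i\<le>d. k ^ i) + k * k ^ d \<le> (1 + k) ^ d + k * (1 + k) ^ d"
      by (rule add_mono)
    then show ?case by simp
  qed simp
  have "v \<in> {xs. set xs \<subseteq> {..<k} \<and> length xs \<le> depth t}" if "v \<in> nodes t" for v
  proof -
    have "i < k" if i: "i \<in> set v" for i
    proof -
      obtain us ws where "v = (us @ [i]) @ ws"
        using split_list[OF i] by auto
      with \<open>v \<in> nodes t\<close> have "us @ [i] \<in> nodes t"
        by (metis append_in_nodesD)
      then show ?thesis
        unfolding k_def by (rule index_less_max_children)
    qed
    with that length_le_depth show ?thesis by auto
  qed
  then have "num_nodes t \<le> card {xs. set xs \<subseteq> {..<k} \<and> length xs \<le> depth t}"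
    unfolding num_nodes_def by (intro card_mono finite_lists_length_le) auto
  also have "\<dots> = (\<Sum>i\<le>depth t. k ^ i)"
    by (simp add: card_lists_length_le)
  also have "\<dots> \<le> (1 + k) ^ depth t"
    by (rule geometric_sum)
  finally show ?thesis by (simp add: k_def)
qed

lemma num_nodes_le_exp:
  "real (num_nodes t) \<le> exp (real (max_children t) * real (depth t))"
proof -
  have "real (num_nodes t) \<le> (1 + real (max_children t)) ^ depth t"
    using num_nodes_le[of t] by (metis of_nat_1 of_nat_add of_nat_le_iff of_nat_power)
  also have "\<dots> \<le> exp (real (max_children t)) ^ depth t"
    by (intro power_mono) auto
  finally show ?thesis
    by (simp add: exp_of_nat2_mult)
qed

section \<open>Children hanging off the path to a node\<close>

text \<open>Proper prefixes only: the set holds the non-root nodes of the path and all their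
  siblings, but nothing below \<open>v\<close>.\<close>

definition path_children :: "'l otree \<Rightarrow> nat list \<Rightarrow> nat list set" where
  "path_children t v = (\<Union>u \<in> {u. strict_prefix u v}. children t u)"

lemma finite_path_children [simp]: "finite (path_children t v)"
  by (rule finite_subset[of _ "nodes t"]) (auto simp: path_children_def children_def)

lemma path_children_subset: "path_children t v \<subseteq> nodes t - {[]}"
  by (auto simp: path_children_def children_def)

lemma card_path_children_le:
  assumes "v \<in> nodes t"
  shows "card (path_children t v) \<le> max_children t * depth t"
proof -
  have eq: "{u. strict_prefix u v} = (\<lambda>m. take m v) ` {..<length v}"
  proof (intro set_eqI iffI)
    fix u assume "u \<in> {u. strict_prefix u v}"
    then obtain w where "v = u @ w" "w \<noteq> []"
      by (auto elim!: strict_prefixE' simp: prefix_def)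
    then show "u \<in> (\<lambda>m. take m v) ` {..<length v}"
      by (intro image_eqI[of _ _ "length u"]) auto
  next
    fix u assume "u \<in> (\<lambda>m. take m v) ` {..<length v}"
    then obtain m where "m < length v" "u = take m v" by auto
    then show "u \<in> {u. strict_prefix u v}"
      by (auto simp: strict_prefix_def take_is_prefix)
  qed
  have "card (path_children t v) \<le> (\<Sum>u\<in>{u. strict_prefix u v}. card (children t u))"
    unfolding path_children_def by (rule card_UN_le) (simp add: eq)
  also have "\<dots> \<le> (\<Sum>u\<in>{u. strict_prefix u v}. max_children t)"
    using assms by (intro sum_mono card_children_le)
      (auto simp: strict_prefix_def prefix_def intro: append_in_nodesD)
  also have "\<dots> \<le> length v * max_children t"
    using card_image_le[of "{..<length v}" "\<lambda>m. take m v"] by (simp add: eq)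
  also have "\<dots> \<le> depth t * max_children t"
    using length_le_depth[OF assms] by simp
  finally show ?thesis by (simp add: mult.commute)
qed

text \<open>The set is closed under passing to non-root ancestors, because the parent
  \<open>butlast u\<close> of such an ancestor \<open>u\<close> is again a proper prefix of
  \<open>v\<close>. So absence of marks on the set already rules out deletion.\<close>

lemma not_aon_deleted_path_children:
  assumes M: "\<forall>u \<in> path_children t v. \<not> M u" and w: "w \<in> path_children t v"
  shows "\<not> aon_deleted M w"
proof
  assume "aon_deleted M w"
  then obtain u where u: "u \<noteq> []" "prefix u w" "M u"
    by (auto simp: aon_deleted_def)
  from w obtain w' i where w': "strict_prefix w' v" "w = w' @ [i]" "w \<in> nodes t"
    by (auto simp: path_children_def children_def)
  have "strict_prefix (butlast u) v"
  proof -
    have "prefix (butlast u) w'"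
      using u(2) w'(2) by (auto simp: prefix_snoc intro: prefix_order.trans[OF prefixeq_butlast])
    with w'(1) show ?thesis by (rule prefix_order.le_less_trans[rotated])
  qed
  moreover have "u \<in> nodes t"
    using u(2) w'(3) append_in_nodesD by (auto simp: prefix_def)
  ultimately have "u \<in> path_children t v"
    using u(1) by (auto simp: path_children_def children_def
        intro!: exI[of _ "butlast u"] exI[of _ "last u"])
  with M u(3) show False by blast
qed

section \<open>Recovering labels from the topology and a trace\<close>

lemma topology_ONode_eqD:
  assumes "tree_topology (ONode ts) = tree_topology (ONode us)"
  shows "length ts = length us"
    and "i < length ts \<Longrightarrow> tree_topology (snd (ts ! i)) = tree_topology (snd (us ! i))"
proof -
  have eq: "map (map_prod (\<lambda>_. ()) (map_otree (\<lambda>_. ()))) ts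
          = map (map_prod (\<lambda>_. ()) (map_otree (\<lambda>_. ()))) us"
    using assms by (simp add: tree_topology_def)
  show len: "length ts = length us"
    using arg_cong[OF eq, of length] by simp
  show "i < length ts \<Longrightarrow> tree_topology (snd (ts ! i)) = tree_topology (snd (us ! i))"
    using arg_cong[OF eq, of "\<lambda>xs. snd (xs ! i)"] len by (simp add: tree_topology_def)
qed

text \<open>Reduces reconstruction of the whole tree to one label at a time, which a single trace
  can settle.\<close>

lemma otree_eqI:
  assumes "tree_topology s = tree_topology t"
    and "\<And>v. v \<in> nodes s \<Longrightarrow> v \<noteq> [] \<Longrightarrow> label s v = label t v"
  shows "s = t"
  using assms
proof (induction s arbitrary: t rule: nodes.induct)
  case (1 ts)
  obtain us where t: "t = ONode us" by (cases t)
  note top = topology_ONode_eqD[OF 1(2)[unfolded t]]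
  have "ts = us"
  proof (rule nth_equalityI)
    fix i assume i: "i < length ts"
    have "fst (ts ! i) = fst (us ! i)"
      using 1(3)[of "[i]"] i by (simp add: t)
    moreover have "snd (ts ! i) = snd (us ! i)"
    proof (rule 1(1))
      fix v assume "v \<in> nodes (snd (ts ! i))" "v \<noteq> []"
      then show "label (snd (ts ! i)) v = label (snd (us ! i)) v"
        using 1(3)[of "i # v"] i by (simp add: t)
    qed (use i top in auto)
    ultimately show "ts ! i = us ! i"
      by (rule prod_eqI)
  qed (rule top)
  then show ?case by (simp add: t)
qed

lemma filter_upt_full:
  assumes "length (filter P [0..<n]) = n"
  shows "filter P [0..<n] = [0..<n]"
proof (rule filter_True, rule ballI, rule ccontr)
  fix x assume "x \<in> set [0..<n]" "\<not> P x"
  with length_filter_less[of x "[0..<n]" P] assms show False by simp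
qed

text \<open>
  The children counts of the trace along \<open>v\<close> force \<open>D'\<close> to keep all children along \<open>v\<close>, too.
\<close>

lemma label_determined:
  assumes "tree_topology s = tree_topology t"
    and "surviving D s = surviving D' t"
    and "v \<in> nodes s" "v \<noteq> []"
    and "\<And>u. u \<in> path_children s v \<Longrightarrow> \<not> D u"
  shows "label s v = label t v"
  using assms
\<comment> \<open>Descending to child \<open>i\<close> replaces both deletion predicates by their
  shifts along \<open>i\<close>, so they vary in the induction.\<close>
proof (induction v arbitrary: s t D D')
  case (Cons i v)
  obtain ts us where s: "s = ONode ts" and t: "t = ONode us"
    by (cases s, cases t)
  note top = topology_ONode_eqD[OF Cons.prems(1)[unfolded s t]]
  have i: "i < length ts" and v: "v \<in> nodes (snd (ts ! i))"
    using Cons.prems(3) by (auto simp: s)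
  have "\<not> D [j]" if "j < length ts" for j
    using that by (intro Cons.prems(5))
      (auto simp: s path_children_def children_def intro!: exI[of _ "[]"])
  then have F: "filter (\<lambda>j. \<not> D [j]) [0..<length ts] = [0..<length ts]"
    by (intro filter_True) auto
  have eq: "map (\<lambda>j. (fst (ts ! j), surviving (\<lambda>v. D (j # v)) (snd (ts ! j)))) [0..<length ts]
      = map (\<lambda>j. (fst (us ! j), surviving (\<lambda>v. D' (j # v)) (snd (us ! j))))
          (filter (\<lambda>j. \<not> D' [j]) [0..<length us])"
    using Cons.prems(2) by (simp add: s t F)
  have F': "filter (\<lambda>j. \<not> D' [j]) [0..<length us] = [0..<length us]"
    using arg_cong[OF eq, of length] top(1) by (intro filter_upt_full) simp
  have "fst (ts ! i) = fst (us ! i)"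
    and surv: "surviving (\<lambda>v. D (i # v)) (snd (ts ! i)) = surviving (\<lambda>v. D' (i # v)) (snd (us ! i))"
    using arg_cong[OF eq[unfolded F'], of "\<lambda>xs. xs ! i"] i top(1) by auto
  moreover have "label (snd (ts ! i)) v = label (snd (us ! i)) v" if "v \<noteq> []"
  proof (rule Cons.IH[OF top(2)[OF i] surv v that])
    fix u assume "u \<in> path_children (snd (ts ! i)) v"
    then obtain w where "strict_prefix w v" "u \<in> children (snd (ts ! i)) w"
      by (auto simp: path_children_def)
    then have "strict_prefix (i # w) (i # v)" "i # u \<in> children s (i # w)"
      using i by (auto simp: s children_def)
    then show "\<not> D (i # u)"
      by (intro Cons.prems(5)) (unfold path_children_def, blast)
  qed
  ultimately show ?case by (simp add: s t)
qed simp

section \<open>Probability of a revealing trace\<close>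

text \<open>A set of traces, not of markings, since the estimator sees traces only; some marking
  that produces the trace has to leave the path children unmarked.\<close>

definition revealing_traces :: "'l otree \<Rightarrow> nat list \<Rightarrow> 'l otree set" where
  "revealing_traces t v =
     {surviving (aon_deleted M) t | M. \<forall>u \<in> path_children t v. \<not> M u}"

text \<open>Marks are independent, so the path children are all unmarked with probability
  \<open>1 - q\<close> to the power of their number.\<close>

lemma prob_revealing_traces:
  assumes q: "0 \<le> q" "q < 1" and v: "v \<in> nodes t"
  shows "(1 - q) ^ (max_children t * depth t)
    \<le> measure_pmf.prob (aon_trace_pmf q t) (revealing_traces t v)"
proof -
  let ?N = "nodes t - {[]}" and ?A = "path_children t v"
  let ?B = "\<lambda>u. if u \<in> ?A then {False} else UNIV"
  have "(1 - q) ^ (max_children t * depth t) \<le> (1 - q) ^ card ?A"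
    using q card_path_children_le[OF v] by (intro power_decreasing) auto
  also have "\<dots> = (\<Prod>u\<in>?N. if u \<in> ?A then 1 - q else 1)"
    using path_children_subset[of t v]
    by (simp add: prod.If_cases Int_absorb1)
  also have "\<dots> = (\<Prod>u\<in>?N. measure_pmf.prob (bernoulli_pmf q) (?B u))"
    using q by (intro prod.cong) (auto simp: measure_pmf_single)
  also have "\<dots> = measure_pmf.prob (marking_pmf q t) (Pi ?N ?B)"
    unfolding marking_pmf_def by (subst measure_Pi_pmf_Pi) auto
  \<comment> \<open>Only an inclusion of events: a marking that hits a path child may still produce
    a revealing trace.\<close>
  also have "\<dots> \<le> measure_pmf.prob (marking_pmf q t)
      ((\<lambda>M. surviving (aon_deleted M) t) -` revealing_traces t v)"
    using path_children_subset[of t v]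
    by (intro measure_pmf.finite_measure_mono) (fastforce simp: revealing_traces_def Pi_def)+
  finally show ?thesis
    by (simp add: aon_trace_pmf_def)
qed

section \<open>Independent traces and the estimator\<close>

text \<open>The product rule is applied to countable sets, so both factors are first cut down to the
  supports, which changes no probability.\<close>

lemma prob_pair_pmf_Times:
  "measure_pmf.prob (pair_pmf p r) (A \<times> B) = measure_pmf.prob p A * measure_pmf.prob r B"
proof -
  have "measure_pmf.prob (pair_pmf p r) (A \<times> B)
      = measure_pmf.prob (pair_pmf p r) ((A \<inter> set_pmf p) \<times> (B \<inter> set_pmf r))"
    by (subst measure_Int_set_pmf[symmetric]) (simp add: Times_Int_Times)
  also have "\<dots> = measure_pmf.prob p (A \<inter> set_pmf p) * measure_pmf.prob r (B \<inter> set_pmf r)"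
    by (rule measure_pmf_prob_product) (auto intro: countable_Int2)
  finally show ?thesis by (simp add: measure_Int_set_pmf)
qed

lemma prob_replicate_pmf_all:
  "measure_pmf.prob (replicate_pmf m p) {xs. set xs \<subseteq> B} = measure_pmf.prob p B ^ m"
proof (induction m)
  case (Suc m)
  have "measure_pmf.prob (replicate_pmf (Suc m) p) {xs. set xs \<subseteq> B}
      = measure_pmf.prob (pair_pmf p (replicate_pmf m p)) (B \<times> {xs. set xs \<subseteq> B})"
  proof -
    have "replicate_pmf (Suc m) p = map_pmf (\<lambda>(x, xs). x # xs) (pair_pmf p (replicate_pmf m p))"
      by (simp add: pair_pmf_def map_bind_pmf)
    moreover have "(\<lambda>(x, xs). x # xs) -` {xs. set xs \<subseteq> B} = B \<times> {xs. set xs \<subseteq> B}"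
      by auto
    ultimately show ?thesis by simp
  qed
  then show ?case
    using Suc by (simp add: prob_pair_pmf_Times)
qed simp

text \<open>
  The true tree always satisfies the predicate below, so \<open>SOME\<close> is never applied to an empty
  predicate; it is the only such tree once every node is revealed by some trace.
\<close>

definition consistent_tree :: "unit otree \<Rightarrow> 'l otree list \<Rightarrow> 'l otree" where
  "consistent_tree S traces = (SOME t. tree_topology t = S \<and>
     (\<forall>tr \<in> set traces. \<exists>M. tr = surviving (aon_deleted M) t))"

text \<open>The first assumption makes \<open>t\<close> a candidate; the second makes every other
  candidate agree with \<open>t\<close> on all labels.\<close>

lemma consistent_tree_eq:
  assumes tr: "set traces \<subseteq> set_pmf (aon_trace_pmf q t)"
    and rev: "\<And>v. v \<in> nodes t \<Longrightarrow> v \<noteq> [] \<Longrightarrow> set traces \<inter> revealing_traces t v \<noteq> {}"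
  shows "consistent_tree (tree_topology t) traces = t"
  unfolding consistent_tree_def
proof (rule some_equality)
  show "tree_topology t = tree_topology t \<and>
      (\<forall>tr \<in> set traces. \<exists>M. tr = surviving (aon_deleted M) t)"
    using tr by (auto simp: aon_trace_pmf_def)
next
  fix s assume s: "tree_topology s = tree_topology t \<and>
      (\<forall>tr \<in> set traces. \<exists>M. tr = surviving (aon_deleted M) s)"
  have labels: "label t v = label s v" if v: "v \<in> nodes t" "v \<noteq> []" for v
  proof -
    obtain M where M: "surviving (aon_deleted M) t \<in> set traces"
        "\<forall>u \<in> path_children t v. \<not> M u"
      using rev[OF v] by (auto simp: revealing_traces_def)
    obtain M' where "surviving (aon_deleted M) t = surviving (aon_deleted M') s"
      using s M(1) by blast
    \<comment> \<open>Only the marking \<open>M\<close> of \<open>t\<close> is known to spare the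
      path; \<open>M'\<close> is an arbitrary marking of the rival tree \<open>s\<close>.\<close>
    with s v M(2) show ?thesis
      by (intro label_determined[of t s "aon_deleted M" "aon_deleted M'"])
        (auto dest: not_aon_deleted_path_children)
  qed
  from s have "tree_topology t = tree_topology s"
    by simp
  from otree_eqI[OF this labels] show "s = t" ..
qed

text \<open>Union bound over the nodes: all \<open>m\<close> traces fail to reveal a given node with
  probability at most \<open>(1 - p) ^ m\<close>, hence at most
  \<open>exp (- (p * m))\<close>.\<close>

lemma prob_consistent_tree:
  fixes t :: "'l otree"
  assumes q: "0 \<le> q" "q < 1"
  defines "p \<equiv> (1 - q) ^ (max_children t * depth t)"
  shows "measure_pmf.prob (replicate_pmf m (aon_trace_pmf q t))
      {traces. consistent_tree (tree_topology t) traces = t}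
    \<ge> 1 - real (num_nodes t) * exp (- (p * real m))"
proof -
  let ?P = "replicate_pmf m (aon_trace_pmf q t)"
  let ?G = "{traces. consistent_tree (tree_topology t) traces = t}"
  let ?F = "\<lambda>v. {traces. set traces \<subseteq> - revealing_traces t v}"
  have "measure_pmf.prob ?P (- ?G) \<le> measure_pmf.prob ?P (\<Union>v\<in>nodes t. ?F v)"
  proof (rule measure_pmf.finite_measure_mono_AE)
    \<comment> \<open>The inclusion holds only for lists of traces that can occur, since other lists
      may be inconsistent with the true tree.\<close>
    show "AE x in ?P. x \<in> - ?G \<longrightarrow> x \<in> (\<Union>v\<in>nodes t. ?F v)"
    proof (intro AE_pmfI impI)
      fix traces assume "traces \<in> set_pmf ?P" "traces \<in> - ?G"
      moreover from this(1) have "set traces \<subseteq> set_pmf (aon_trace_pmf q t)"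
        by (auto simp: set_replicate_pmf)
      ultimately show "traces \<in> (\<Union>v\<in>nodes t. ?F v)"
        using consistent_tree_eq[of traces q t] by blast
    qed
  qed simp
  also have "\<dots> \<le> (\<Sum>v\<in>nodes t. measure_pmf.prob ?P (?F v))"
    by (intro measure_pmf.finite_measure_subadditive_finite) auto
  also have "\<dots> \<le> (\<Sum>v\<in>nodes t. exp (- (p * real m)))"
  proof (rule sum_mono)
    fix v assume v: "v \<in> nodes t"
    let ?r = "measure_pmf.prob (aon_trace_pmf q t) (revealing_traces t v)"
    have "measure_pmf.prob ?P (?F v) = (1 - ?r) ^ m"
      by (simp add: prob_replicate_pmf_all measure_pmf.prob_compl[simplified] Compl_eq_Diff_UNIV)
    also have "\<dots> \<le> exp (- p) ^ m"
    proof (rule power_mono)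
      have "1 - ?r \<le> 1 + (- p)"
        using prob_revealing_traces[OF q v] by (simp add: p_def)
      also have "\<dots> \<le> exp (- p)"
        by (rule exp_ge_add_one_self)
      finally show "1 - ?r \<le> exp (- p)" .
    qed simp
    finally show "measure_pmf.prob ?P (?F v) \<le> exp (- (p * real m))"
      by (simp add: exp_of_nat2_mult[symmetric])
  qed
  finally show ?thesis
    by (simp add: num_nodes_def measure_pmf.prob_compl[simplified] Compl_eq_Diff_UNIV)
qed

section \<open>Choice of the constant and passage to the limit\<close>

theorem theorem4:
  fixes q :: real
  assumes "0 \<le> q" and "q < 1"
  shows "\<exists>C :: real. \<exists>est :: unit otree \<Rightarrow> bool otree list \<Rightarrow> bool otree.
    \<forall>\<epsilon> > 0. \<forall>\<^sub>F n in sequentially. \<forall>X :: bool otree. num_nodes X = n \<longrightarrow>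
      measure_pmf.prob
        (replicate_pmf (nat \<lceil>exp (C * real (max_children X) * real (depth X))\<rceil>) (aon_trace_pmf q X))
        {traces. est (tree_topology X) traces = X} \<ge> 1 - \<epsilon>"
proof -
  \<comment> \<open>The term \<open>- ln (1 - q)\<close> cancels the probability
    \<open>p = exp (ln (1 - q) * a)\<close>, and the 2 leaves \<open>exp (2 * a)\<close>, which
    dominates the square of the number of nodes.\<close>
  define C where "C = 2 - ln (1 - q)"
  \<comment> \<open>The right-hand side depends on \<open>X\<close> only through its number of
    nodes, which gives uniformity over all trees with \<open>n\<close> nodes.\<close>
  have bound: "measure_pmf.prob
        (replicate_pmf (nat \<lceil>exp (C * real (max_children X) * real (depth X))\<rceil>) (aon_trace_pmf q X))
        {traces. consistent_tree (tree_topology X) traces = X}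
      \<ge> 1 - real (num_nodes X) * exp (- (real (num_nodes X))\<^sup>2)" for X :: "bool otree"
  proof -
    define a where "a = real (max_children X) * real (depth X)"
    define m where "m = nat \<lceil>exp (C * real (max_children X) * real (depth X))\<rceil>"
    define p where "p = (1 - q) ^ (max_children X * depth X)"
    have p: "p = exp (ln (1 - q) * a)"
      using assms by (simp add: p_def a_def powr_realpow[symmetric] powr_def mult.commute)
    have "(real (num_nodes X))\<^sup>2 \<le> (exp a)\<^sup>2"
      unfolding a_def by (intro power_mono num_nodes_le_exp) simp
    also have "\<dots> = p * exp (C * a)"
      by (simp add: p C_def exp_add[symmetric] exp_double[symmetric] algebra_simps)
    also have "\<dots> \<le> p * real m"
      unfolding m_def a_def p by (intro mult_left_mono) (auto simp: mult.assoc intro: real_nat_ceiling_ge)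
    finally have "real (num_nodes X) * exp (- (p * real m))
        \<le> real (num_nodes X) * exp (- (real (num_nodes X))\<^sup>2)"
      by (intro mult_left_mono) auto
    with prob_consistent_tree[OF assms, where t = X and m = m] show ?thesis
      by (simp add: p_def m_def)
  qed
  have lim: "(\<lambda>n. real n * exp (- (real n)\<^sup>2)) \<longlonglongrightarrow> 0"
    by real_asymp
  show ?thesis
  proof (intro exI[of _ C] exI[of _ consistent_tree] allI impI)
    fix \<epsilon> :: real assume "\<epsilon> > 0"
    with lim have "\<forall>\<^sub>F n in sequentially. real n * exp (- (real n)\<^sup>2) < \<epsilon>"
      by (rule order_tendstoD)
    then show "\<forall>\<^sub>F n in sequentially. \<forall>X :: bool otree. num_nodes X = n \<longrightarrow>
      measure_pmf.prob
        (replicate_pmf (nat \<lceil>exp (C * real (max_children X) * real (depth X))\<rceil>) (aon_trace_pmf q X))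
        {traces. consistent_tree (tree_topology X) traces = X} \<ge> 1 - \<epsilon>"
    proof eventually_elim
      case (elim n)
      then show ?case
        using bound by (smt (verit))
    qed
  qed
qed

end
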